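(* Let $\Gamma=\Gamma(V,E)$ be a graph and let $\mathcal{M}=\{M_\alpha:\alpha\in V\}$ be a set of mutually disjoint monoids, each of which is left abundant. Then the graph product $\mathscr{GP}(\Gamma,\mathcal{M})$ of $\mathcal{M}$ with respect to $\Gamma$ is left abundant.
   Context: Graphs: $\Gamma=\Gamma(V,E)$ is a simple undirected graph without loops, with vertex set $V$ (possibly infinite), $|V|\ge 2$, and edge set $E$ a set of $2$-element subsets of $V$; write $(\alpha,\beta)\in E$ for $\{\alpha,\beta\}\in E$. Graph product: let $1_\alpha$ be the identity of $M_\alpha$ and $X=\bigcup_{\alpha\in V}M_\alpha$. Let $X^*$ be the free monoid on $X$, with juxtaposition written $\circ$ and empty word $\epsilon$. The graph product is the monoid $\mathscr{GP}(\Gamma,\mathcal{M})=X^*/R^\sharp$, where $R^\sharp$ is the congruence on $X^*$ generated by the relations: $1_\alpha=\epsilon$ ($\alpha\in V$); $x\circ y=xy$ ($x,y\in M_\alpha$, $\alpha\in V$, with $xy$ the product in $M_\alpha$); $x\circ y=y\circ x$ ($x\in M_\alpha$, $y\in M_\beta$, $(\alpha,\beta)\in E$). Left abundant: on a monoid $M$, $a\,\mathcal{R}^*\,b$ means that for all $x,y\in M$, $xa=ya$ if and only if $xb=yb$. $M$ is left abundant if every element of $M$ is $\mathcal{R}^*$-related to an idempotent of $M$. *)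

theory Defs
  imports "HOL-Algebra.Coset" "HOL-Library.Disjoint_Sets"
begin

locale simple_graph =
  fixes V :: "'v set" and E :: "'v set set"
  assumes edges: "E \<subseteq> {e. e \<subseteq> V \<and> card e = 2}"
    and two_vertices: "\<exists>\<alpha>\<in>V. \<exists>\<beta>\<in>V. \<alpha> \<noteq> \<beta>"

definition Rstar :: "('a, 'm) monoid_scheme \<Rightarrow> 'a \<Rightarrow> 'a \<Rightarrow> bool" where
  "Rstar M a b \<longleftrightarrow>
     (\<forall>x\<in>carrier M. \<forall>y\<in>carrier M.
        x \<otimes>\<^bsub>M\<^esub> a = y \<otimes>\<^bsub>M\<^esub> a \<longleftrightarrow> x \<otimes>\<^bsub>M\<^esub> b = y \<otimes>\<^bsub>M\<^esub> b)"

locale left_abundant_monoid = monoid +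
  assumes Rstar_idempotent: "a \<in> carrier G \<Longrightarrow> \<exists>e\<in>carrier G. e \<otimes> e = e \<and> Rstar G a e"

definition free_monoid :: "'a set \<Rightarrow> 'a list monoid" where
  "free_monoid X = \<lparr>carrier = lists X, mult = (@), one = []\<rparr>"

definition congruence :: "('a, 'm) monoid_scheme \<Rightarrow> 'a rel \<Rightarrow> bool" where
  "congruence M r \<longleftrightarrow>
     equiv (carrier M) r \<and>
     (\<forall>(a, b)\<in>r. \<forall>(c, d)\<in>r. (a \<otimes>\<^bsub>M\<^esub> c, b \<otimes>\<^bsub>M\<^esub> d) \<in> r)"

definition generated_congruence :: "('a, 'm) monoid_scheme \<Rightarrow> 'a rel \<Rightarrow> 'a rel" where
  "generated_congruence M R = \<Inter>{r. congruence M r \<and> R \<subseteq> r}"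

text \<open>The product of the classes of \<open>a\<close> and \<open>b\<close> is the class of \<open>a \<otimes> b\<close>; it is written here
  as the image under \<open>r\<close> of the complex product, which is a single class when \<open>r\<close> is a
  congruence.\<close>

definition quotient_monoid :: "('a, 'm) monoid_scheme \<Rightarrow> 'a rel \<Rightarrow> 'a set monoid" where
  "quotient_monoid M r =
     \<lparr>carrier = carrier M // r, mult = (\<lambda>A B. r `` (A <#>\<^bsub>M\<^esub> B)), one = r `` {\<one>\<^bsub>M\<^esub>}\<rparr>"

definition graph_product_relations ::
  "'v set \<Rightarrow> 'v set set \<Rightarrow> ('v \<Rightarrow> ('a, 'm) monoid_scheme) \<Rightarrow> 'a list rel" where
  "graph_product_relations V E M =
     {([\<one>\<^bsub>M \<alpha>\<^esub>], []) | \<alpha>. \<alpha> \<in> V} \<union>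
     {([x, y], [x \<otimes>\<^bsub>M \<alpha>\<^esub> y]) | \<alpha> x y. \<alpha> \<in> V \<and> x \<in> carrier (M \<alpha>) \<and> y \<in> carrier (M \<alpha>)} \<union>
     {([x, y], [y, x]) | \<alpha> \<beta> x y.
        \<alpha> \<in> V \<and> \<beta> \<in> V \<and> {\<alpha>, \<beta>} \<in> E \<and> x \<in> carrier (M \<alpha>) \<and> y \<in> carrier (M \<beta>)}"

definition graph_product ::
  "'v set \<Rightarrow> 'v set set \<Rightarrow> ('v \<Rightarrow> ('a, 'm) monoid_scheme) \<Rightarrow> 'a list set monoid" where
  "graph_product V E M =
     (let F = free_monoid (\<Union>\<alpha>\<in>V. carrier (M \<alpha>))
      in quotient_monoid F (generated_congruence F (graph_product_relations V E M)))"

end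

theory Submission
  imports Defs
begin

text \<open>Each \<open>g\<close> in the graph product \<open>G\<close> factors
  uniquely as \<open>g = g' p\<close> with \<open>p \<in> M \<delta>\<close> and \<open>g'\<close> having trivial last \<open>\<delta>\<close>-component, so \<open>G\<close> is a free
  right \<open>M \<delta>\<close>-act and \<open>\<R>\<^sup>*\<close> in \<open>M \<delta>\<close> is inherited by \<open>G\<close>. Take a reduced word. If one of its possible
  first letters \<open>p\<close> has a left inverse \<open>q\<close>, the word is \<open>p b\<close> with \<open>b\<close> shorter, and \<open>b \<R>\<^sup>* e\<close> gives
  \<open>p b \<R>\<^sup>* p e q\<close>. Otherwise nothing multiplied on the left can cancel its first letters, so
  a letter outside the first block of pairwise commuting letters may be dropped without changing the
  \<open>\<R>\<^sup>*\<close>-class, and the block itself is \<open>\<R>\<^sup>*\<close>-related to a product of commuting idempotents.\<close>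

section \<open>The relation \<open>\<R>\<^sup>*\<close>\<close>

lemma Rstar_trans: "Rstar G a b \<Longrightarrow> Rstar G b c \<Longrightarrow> Rstar G a c"
  unfolding Rstar_def by blast

context monoid
begin

lemma Rstar_left_mult:
  assumes "Rstar G a b" "a \<in> carrier G" "b \<in> carrier G" "c \<in> carrier G"
  shows "Rstar G (c \<otimes> a) (c \<otimes> b)"
  using assms unfolding Rstar_def by (simp add: m_assoc [symmetric])

text \<open>Right multiplication by \<open>p\<close> undoes right multiplication by
  \<open>q\<close>, so appending \<open>q\<close> identifies nothing new.\<close>

lemma Rstar_right_invertible:
  assumes "a \<in> carrier G" "p \<in> carrier G" "q \<in> carrier G" "q \<otimes> p = \<one>"
  shows "Rstar G a (a \<otimes> q)"
  unfolding Rstar_def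
proof (intro ballI iffI)
  fix x y assume xy: "x \<in> carrier G" "y \<in> carrier G"
  { assume "x \<otimes> a = y \<otimes> a"
    then show "x \<otimes> (a \<otimes> q) = y \<otimes> (a \<otimes> q)"
      using assms xy by (simp add: m_assoc [symmetric]) }
  { assume "x \<otimes> (a \<otimes> q) = y \<otimes> (a \<otimes> q)"
    then have "x \<otimes> (a \<otimes> q) \<otimes> p = y \<otimes> (a \<otimes> q) \<otimes> p" by simp
    then show "x \<otimes> a = y \<otimes> a" using assms xy by (simp add: m_assoc) }
qed

text \<open>The inner factor \<open>q \<otimes> p\<close> cancels, which makes
  \<open>p \<otimes> e \<otimes> q\<close> idempotent. It is reached in two moves: replace
  \<open>b\<close> by \<open>e\<close> behind \<open>p\<close>, then append \<open>q\<close>, which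
  \<open>p\<close> can undo.\<close>

lemma Rstar_idempotent_left_invertible_mult:
  assumes c: "p \<in> carrier G" "q \<in> carrier G" "b \<in> carrier G" "e \<in> carrier G"
    and qp: "q \<otimes> p = \<one>" and ee: "e \<otimes> e = e" and be: "Rstar G b e"
  shows "\<exists>f\<in>carrier G. f \<otimes> f = f \<and> Rstar G (p \<otimes> b) f"
proof (intro bexI conjI)
  let ?f = "p \<otimes> e \<otimes> q"
  show "?f \<in> carrier G" using c by simp
  have "?f \<otimes> ?f = p \<otimes> (e \<otimes> ((q \<otimes> p) \<otimes> (e \<otimes> q)))" using c by (simp add: m_assoc)
  also have "\<dots> = p \<otimes> ((e \<otimes> e) \<otimes> q)" using c qp by (simp add: m_assoc)
  finally show "?f \<otimes> ?f = ?f" using c ee by (simp add: m_assoc)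
  show "Rstar G (p \<otimes> b) ?f"
    using Rstar_trans [OF Rstar_left_mult [OF be] Rstar_right_invertible] c qp by auto
qed

end

section \<open>Generated congruences and quotients\<close>

lemma congruenceD:
  "congruence N r \<Longrightarrow> (a, b) \<in> r \<Longrightarrow> (c, d) \<in> r \<Longrightarrow> (a \<otimes>\<^bsub>N\<^esub> c, b \<otimes>\<^bsub>N\<^esub> d) \<in> r"
  unfolding congruence_def by blast

lemma generated_congruence_least:
  "congruence N r \<Longrightarrow> R \<subseteq> r \<Longrightarrow> generated_congruence N R \<subseteq> r"
  unfolding generated_congruence_def by blast

lemma generated_congruence_extensive: "R \<subseteq> generated_congruence N R"
  unfolding generated_congruence_def by blast

lemma congruence_generated_congruence:
  assumes "monoid N" "R \<subseteq> carrier N \<times> carrier N"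
  shows "congruence N (generated_congruence N R)"
proof -
  interpret monoid N by fact
  let ?C = "{r. congruence N r \<and> R \<subseteq> r}"
  \<comment> \<open>The full relation keeps the intersected family nonempty and so bounds its
    intersection by the carrier.\<close>
  have full: "carrier N \<times> carrier N \<in> ?C"
    using assms(2) by (auto simp: congruence_def equiv_def refl_on_def sym_def trans_def)
  have eq: "equiv (carrier N) r" if "r \<in> ?C" for r
    using that by (simp add: congruence_def)
  have "equiv (carrier N) (\<Inter>?C)"
  proof (rule equivI)
    show "\<Inter>?C \<subseteq> carrier N \<times> carrier N" using full by blast
    show "refl_on (carrier N) (\<Inter>?C)"
      using eq by (meson InterI equivE refl_on_def)
    show "sym (\<Inter>?C)" by (rule symI) (use eq in \<open>blast elim: equivE dest: symD\<close>)
    show "trans (\<Inter>?C)" by (rule transI) (use eq in \<open>blast elim: equivE dest: transD\<close>)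
  qed
  then show ?thesis
    unfolding generated_congruence_def congruence_def [of N "\<Inter>?C"]
    using congruenceD by fast
qed

lemma mult_quotient_monoid:
  assumes r: "congruence N r" and ab: "a \<in> carrier N" "b \<in> carrier N"
  shows "r `` {a} \<otimes>\<^bsub>quotient_monoid N r\<^esub> r `` {b} = r `` {a \<otimes>\<^bsub>N\<^esub> b}"
proof -
  have eq: "equiv (carrier N) r" using r by (simp add: congruence_def)
  have refl: "(a, a) \<in> r" "(b, b) \<in> r" using eq ab by (auto elim: equivE dest: refl_onD)
  have "r `` (r `` {a} <#>\<^bsub>N\<^esub> r `` {b}) = r `` {a \<otimes>\<^bsub>N\<^esub> b}"
  proof (intro equalityI subsetI)
    fix z assume "z \<in> r `` (r `` {a} <#>\<^bsub>N\<^esub> r `` {b})"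
    then obtain h k where "(a, h) \<in> r" "(b, k) \<in> r" "(h \<otimes>\<^bsub>N\<^esub> k, z) \<in> r"
      by (auto simp: set_mult_def)
    then show "z \<in> r `` {a \<otimes>\<^bsub>N\<^esub> b}"
      using congruenceD [OF r] eq by (blast elim: equivE dest: transD)
  next
    fix z assume "z \<in> r `` {a \<otimes>\<^bsub>N\<^esub> b}"
    then show "z \<in> r `` (r `` {a} <#>\<^bsub>N\<^esub> r `` {b})"
      using refl by (auto simp: set_mult_def)
  qed
  then show ?thesis by (simp add: quotient_monoid_def)
qed

lemma monoid_quotient_monoid:
  assumes "monoid N" and r: "congruence N r"
  shows "monoid (quotient_monoid N r)"
proof -
  interpret monoid N by fact
  let ?Q = "quotient_monoid N r"
  have carr: "carrier ?Q = (\<lambda>a. r `` {a}) ` carrier N"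
    by (auto simp: quotient_monoid_def quotient_def)
  have one: "\<one>\<^bsub>?Q\<^esub> = r `` {\<one>\<^bsub>N\<^esub>}" by (simp add: quotient_monoid_def)
  show ?thesis
    by (rule Group.monoidI)
      (auto simp: carr one mult_quotient_monoid [OF r] m_assoc)
qed

section \<open>Reduced words\<close>

locale graph_of_monoids = simple_graph V E
  for V :: "'v set" and E :: "'v set set" +
  fixes M :: "'v \<Rightarrow> ('a, 'm) monoid_scheme"
  assumes disjoint: "disjoint_family_on (\<lambda>\<alpha>. carrier (M \<alpha>)) V"
    and monoid_M: "\<alpha> \<in> V \<Longrightarrow> monoid (M \<alpha>)"
begin

definition letters :: "'a set" where
  "letters = (\<Union>\<alpha>\<in>V. carrier (M \<alpha>))"

text \<open>Disjointness makes the vertex of a letter unique; outside \<open>letters\<close> the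
  value is unspecified.\<close>

definition vtx :: "'a \<Rightarrow> 'v" where
  "vtx x = (THE \<alpha>. \<alpha> \<in> V \<and> x \<in> carrier (M \<alpha>))"

definition adj :: "'v \<Rightarrow> 'v \<Rightarrow> bool" where
  "adj \<alpha> \<beta> \<longleftrightarrow> {\<alpha>, \<beta>} \<in> E"

lemma vtx_eq: "\<alpha> \<in> V \<Longrightarrow> x \<in> carrier (M \<alpha>) \<Longrightarrow> vtx x = \<alpha>"
  unfolding vtx_def using disjoint
  by (intro the_equality) (auto simp: disjoint_family_on_def)

lemma letters_iff: "x \<in> letters \<longleftrightarrow> vtx x \<in> V \<and> x \<in> carrier (M (vtx x))"
  unfolding letters_def using vtx_eq by auto

lemma carrier_letters: "\<alpha> \<in> V \<Longrightarrow> x \<in> carrier (M \<alpha>) \<Longrightarrow> x \<in> letters"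
  unfolding letters_def by auto

lemma adj_sym: "adj \<alpha> \<beta> \<longleftrightarrow> adj \<beta> \<alpha>"
  by (simp add: adj_def insert_commute)

lemma adj_irrefl [simp]: "\<not> adj \<alpha> \<alpha>"
  using edges by (auto simp: adj_def)

lemma adj_vertices: "adj \<alpha> \<beta> \<Longrightarrow> \<alpha> \<in> V \<and> \<beta> \<in> V"
  using edges by (auto simp: adj_def)

lemma one_M_closed: "\<alpha> \<in> V \<Longrightarrow> \<one>\<^bsub>M \<alpha>\<^esub> \<in> carrier (M \<alpha>)"
  by (simp add: monoid_M monoid.one_closed)

lemma mult_M_closed:
  "\<alpha> \<in> V \<Longrightarrow> x \<in> carrier (M \<alpha>) \<Longrightarrow> y \<in> carrier (M \<alpha>) \<Longrightarrow> x \<otimes>\<^bsub>M \<alpha>\<^esub> y \<in> carrier (M \<alpha>)"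
  by (simp add: monoid_M monoid.m_closed)

lemma l_one_M: "\<alpha> \<in> V \<Longrightarrow> x \<in> carrier (M \<alpha>) \<Longrightarrow> \<one>\<^bsub>M \<alpha>\<^esub> \<otimes>\<^bsub>M \<alpha>\<^esub> x = x"
  by (simp add: monoid_M monoid.l_one)

lemma r_one_M: "\<alpha> \<in> V \<Longrightarrow> x \<in> carrier (M \<alpha>) \<Longrightarrow> x \<otimes>\<^bsub>M \<alpha>\<^esub> \<one>\<^bsub>M \<alpha>\<^esub> = x"
  by (simp add: monoid_M monoid.r_one)

lemmas M_simps = one_M_closed mult_M_closed l_one_M r_one_M

text \<open>Reduced words are stored in reverse: the head of the list is the last letter of the word.
  The letter \<open>lastc \<delta> w\<close> is the last \<open>\<delta>\<close>-component of \<open>w\<close>, provided that \<open>w\<close> is reduced.\<close>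

primrec lastc :: "'v \<Rightarrow> 'a list \<Rightarrow> 'a" where
  "lastc \<delta> [] = \<one>\<^bsub>M \<delta>\<^esub>"
| "lastc \<delta> (t # w) =
     (if vtx t = \<delta> then t else if adj (vtx t) \<delta> then lastc \<delta> w else \<one>\<^bsub>M \<delta>\<^esub>)"

text \<open>Removes the letter that the scan of \<open>lastc\<close> finds, crossing only letters
  adjacent to \<delta>; a scan that is blocked or runs out changes nothing.\<close>

primrec del :: "'v \<Rightarrow> 'a list \<Rightarrow> 'a list" where
  "del \<delta> [] = []"
| "del \<delta> (t # w) =
     (if vtx t = \<delta> then w else if adj (vtx t) \<delta> then t # del \<delta> w else t # w)"

text \<open>As all letters of \<open>w\<close> are nontrivial, the \<open>lastc\<close> clause says
  that no earlier letter at the vertex of \<open>t\<close> can be moved next to \<open>t\<close> and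
  merged with it.\<close>

primrec reduced :: "'a list \<Rightarrow> bool" where
  "reduced [] \<longleftrightarrow> True"
| "reduced (t # w) \<longleftrightarrow>
     t \<in> letters \<and> t \<noteq> \<one>\<^bsub>M (vtx t)\<^esub> \<and> lastc (vtx t) w = \<one>\<^bsub>M (vtx t)\<^esub> \<and> reduced w"

text \<open>Equality of words up to exchanging neighbours at adjacent vertices. Symmetry is
  derivable because a swap is undone by a swap.\<close>

inductive shuffle :: "'a list \<Rightarrow> 'a list \<Rightarrow> bool" where
  shuffle_swap: "adj (vtx s) (vtx t) \<Longrightarrow> shuffle (s # t # w) (t # s # w)"
| shuffle_Cons: "shuffle u v \<Longrightarrow> shuffle (t # u) (t # v)"
| shuffle_refl: "shuffle u u"
| shuffle_trans: "shuffle u v \<Longrightarrow> shuffle v w \<Longrightarrow> shuffle u w"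

lemma shuffle_sym: "shuffle u v \<Longrightarrow> shuffle v u"
proof (induction rule: shuffle.induct)
  case (shuffle_swap s t w)
  then show ?case by (simp add: shuffle.shuffle_swap adj_sym)
qed (blast intro: shuffle.intros)+

lemma lastc_shuffle: "shuffle u v \<Longrightarrow> lastc \<delta> u = lastc \<delta> v"
  by (induction rule: shuffle.induct) (auto simp: adj_sym)

lemma del_shuffle: "shuffle u v \<Longrightarrow> shuffle (del \<delta> u) (del \<delta> v)"
  by (induction rule: shuffle.induct) (auto simp: adj_sym intro: shuffle.intros)

lemma set_shuffle: "shuffle u v \<Longrightarrow> set u = set v"
  by (induction rule: shuffle.induct) auto

lemma reduced_letters: "reduced w \<Longrightarrow> set w \<subseteq> letters"
  by (induction w) auto

lemma reduced_letterD: "reduced w \<Longrightarrow> x \<in> set w \<Longrightarrow> x \<in> letters"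
  using reduced_letters by auto

lemma set_del: "set (del \<delta> w) \<subseteq> set w"
  by (induction w) auto

lemma length_del: "length (del \<delta> w) \<le> length w"
  by (induction w) auto

lemma lastc_closed: "\<delta> \<in> V \<Longrightarrow> set w \<subseteq> letters \<Longrightarrow> lastc \<delta> w \<in> carrier (M \<delta>)"
  by (induction w) (auto simp: letters_iff one_M_closed)

text \<open>Where the scan stops at a letter of vertex \<delta>, reducedness forbids a second such
  letter that is reachable behind it.\<close>

lemma lastc_del: "reduced w \<Longrightarrow> lastc \<delta> (del \<delta> w) = \<one>\<^bsub>M \<delta>\<^esub>"
  by (induction w) auto

lemma lastc_del_adj: "adj \<alpha> \<beta> \<Longrightarrow> lastc \<beta> (del \<alpha> w) = lastc \<beta> w"
  by (induction w) (auto simp: adj_sym)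

lemma del_del_adj: "adj \<alpha> \<beta> \<Longrightarrow> del \<alpha> (del \<beta> w) = del \<beta> (del \<alpha> w)"
  by (induction w) (auto simp: adj_sym)

lemma del_eq_self: "reduced w \<Longrightarrow> lastc \<delta> w = \<one>\<^bsub>M \<delta>\<^esub> \<Longrightarrow> del \<delta> w = w"
  by (induction w) (auto split: if_splits)

lemma reduced_del: "reduced w \<Longrightarrow> reduced (del \<delta> w)"
  by (induction w) (auto simp: lastc_del_adj adj_sym)

text \<open>The scan crosses only letters adjacent to \<delta>, so the component it finds can be
  shuffled past them to the end of the word.\<close>

lemma shuffle_lastc_del:
  assumes "\<delta> \<in> V"
  shows "reduced w \<Longrightarrow> lastc \<delta> w \<noteq> \<one>\<^bsub>M \<delta>\<^esub> \<Longrightarrow> shuffle (lastc \<delta> w # del \<delta> w) w"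
proof (induction w)
  case (Cons t w)
  show ?case
  proof (cases "vtx t = \<delta>")
    case False
    with Cons.prems have a: "adj (vtx t) \<delta>" and l: "lastc \<delta> w \<noteq> \<one>\<^bsub>M \<delta>\<^esub>"
      by (auto split: if_splits)
    have "vtx (lastc \<delta> w) = \<delta>"
      using vtx_eq lastc_closed assms reduced_letters Cons.prems by auto
    with a have "shuffle (lastc \<delta> w # t # del \<delta> w) (t # lastc \<delta> w # del \<delta> w)"
      by (intro shuffle_swap) (simp add: adj_sym)
    moreover have "shuffle (t # lastc \<delta> w # del \<delta> w) (t # w)"
      using Cons l by (intro shuffle_Cons) auto
    ultimately show ?thesis using a False by (auto intro: shuffle_trans)
  qed (auto intro: shuffle_refl)
qed simp

text \<open>Nothing in the star of \<delta> blocks the scan, so it meets a letter at \<delta>, which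
  is nontrivial by reducedness.\<close>

lemma reduced_star_lastc:
  assumes "reduced w" "\<forall>s\<in>set w. vtx s = \<delta> \<or> adj (vtx s) \<delta>" "\<exists>s\<in>set w. vtx s = \<delta>"
  shows "lastc \<delta> w \<noteq> \<one>\<^bsub>M \<delta>\<^esub>"
  using assms by (induction w) auto

section \<open>The action of letters on reduced words\<close>

text \<open>Right multiplication by a letter on normal forms, in the manner of van der Waerden: the
  last component is merged with \<open>t\<close> and put at the end, or dropped if the product is
  the identity.\<close>

definition act1 :: "'a list \<Rightarrow> 'a \<Rightarrow> 'a list" where
  "act1 w t =
     (let q = lastc (vtx t) w \<otimes>\<^bsub>M (vtx t)\<^esub> t
      in if q = \<one>\<^bsub>M (vtx t)\<^esub> then del (vtx t) w else q # del (vtx t) w)"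

abbreviation act :: "'a list \<Rightarrow> 'a list \<Rightarrow> 'a list" where
  "act \<equiv> foldl act1"

context
  fixes w :: "'a list" and \<delta> :: 'v and t :: 'a
  assumes w: "reduced w" and \<delta>: "\<delta> \<in> V" and t: "t \<in> carrier (M \<delta>)"
begin

private lemma vt: "vtx t = \<delta>"
  using \<delta> t by (rule vtx_eq)

private lemma q: "lastc \<delta> w \<otimes>\<^bsub>M \<delta>\<^esub> t \<in> carrier (M \<delta>)"
  using w \<delta> t by (simp add: mult_M_closed lastc_closed reduced_letters)

private lemma vq: "vtx (lastc \<delta> w \<otimes>\<^bsub>M \<delta>\<^esub> t) = \<delta>"
  using \<delta> q by (rule vtx_eq)

lemma reduced_act1: "reduced (act1 w t)"
  using w q vq carrier_letters [OF \<delta> q]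
  by (auto simp: act1_def Let_def vt reduced_del lastc_del)

lemma lastc_act1: "lastc \<delta> (act1 w t) = lastc \<delta> w \<otimes>\<^bsub>M \<delta>\<^esub> t"
  using w vq by (auto simp: act1_def Let_def vt lastc_del)

lemma del_act1: "del \<delta> (act1 w t) = del \<delta> w"
  using w vq by (auto simp: act1_def Let_def vt del_eq_self reduced_del lastc_del)

lemma lastc_act1_adj: "adj \<delta> \<beta> \<Longrightarrow> lastc \<beta> (act1 w t) = lastc \<beta> w"
  using vq by (auto simp: act1_def Let_def vt lastc_del_adj)

text \<open>The merged letter stays at the end of the word and blocks the scan for \<beta>.\<close>

lemma lastc_act1_nonadj:
  "\<beta> \<noteq> \<delta> \<Longrightarrow> \<not> adj \<delta> \<beta> \<Longrightarrow> lastc \<delta> w \<otimes>\<^bsub>M \<delta>\<^esub> t \<noteq> \<one>\<^bsub>M \<delta>\<^esub> \<Longrightarrow>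
    lastc \<beta> (act1 w t) = \<one>\<^bsub>M \<beta>\<^esub>"
  using vq by (auto simp: act1_def Let_def vt)

text \<open>Acting at \<delta> depends only on the last component and on the rest. The first step
  multiplies the component by \<open>t\<close> and keeps the rest, so associativity in
  \<open>M \<delta>\<close> yields equality of lists.\<close>

lemma act1_mult: "s \<in> carrier (M \<delta>) \<Longrightarrow> act1 (act1 w t) s = act1 w (t \<otimes>\<^bsub>M \<delta>\<^esub> s)"
  using lastc_act1 del_act1 vtx_eq [OF \<delta>] \<delta> t w
  by (simp add: act1_def [of "act1 w t"] act1_def [of w "t \<otimes>\<^bsub>M \<delta>\<^esub> s"] mult_M_closed Let_def
      monoid.m_assoc [OF monoid_M] lastc_closed reduced_letters)

lemma del_act1_adj:
  "adj \<delta> \<beta> \<Longrightarrow> del \<beta> (act1 w t) =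
    (if lastc \<delta> w \<otimes>\<^bsub>M \<delta>\<^esub> t = \<one>\<^bsub>M \<delta>\<^esub> then del \<beta> (del \<delta> w)
     else (lastc \<delta> w \<otimes>\<^bsub>M \<delta>\<^esub> t) # del \<beta> (del \<delta> w))"
  using vq by (auto simp: act1_def Let_def vt)

end

text \<open>Only a shuffle, since acting by the identity still moves the \<delta>-component to the
  end of the word.\<close>

lemma act1_one:
  assumes "reduced w" "\<delta> \<in> V"
  shows "shuffle (act1 w \<one>\<^bsub>M \<delta>\<^esub>) w"
  using assms vtx_eq [OF assms(2) one_M_closed]
  by (auto simp: act1_def Let_def M_simps lastc_closed reduced_letters del_eq_self
      shuffle_lastc_del intro: shuffle_refl)

text \<open>Neither letter touches the other's component and the deletions commute, so the results
  differ at most in the order of the two merged letters.\<close>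

lemma act1_commute:
  assumes w: "reduced w" and a: "adj \<alpha> \<beta>"
    and s: "s \<in> carrier (M \<alpha>)" and t: "t \<in> carrier (M \<beta>)"
  shows "shuffle (act1 (act1 w s) t) (act1 (act1 w t) s)"
proof -
  have V: "\<alpha> \<in> V" "\<beta> \<in> V" using adj_vertices [OF a] by auto
  have a': "adj \<beta> \<alpha>" using a by (simp add: adj_sym)
  let ?p = "lastc \<alpha> w \<otimes>\<^bsub>M \<alpha>\<^esub> s" and ?q = "lastc \<beta> w \<otimes>\<^bsub>M \<beta>\<^esub> t"
  have v: "vtx s = \<alpha>" "vtx t = \<beta>" "vtx ?p = \<alpha>" "vtx ?q = \<beta>"
    using V s t w by (auto intro!: vtx_eq mult_M_closed lastc_closed dest: reduced_letters)
  show ?thesis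
    using v a a' lastc_act1_adj [OF w V(1) s a] lastc_act1_adj [OF w V(2) t a']
    by (simp add: act1_def [of "act1 w s"] act1_def [of "act1 w t"] Let_def
        del_act1_adj [OF w V(1) s a] del_act1_adj [OF w V(2) t a'] del_del_adj [OF a]
        shuffle_refl shuffle_swap)
qed

lemma act1_shuffle: "shuffle u v \<Longrightarrow> shuffle (act1 u t) (act1 v t)"
  using lastc_shuffle [of u v "vtx t"] del_shuffle [of u v "vtx t"]
  by (auto simp: act1_def Let_def intro: shuffle_Cons)

lemma act_shuffle: "shuffle u v \<Longrightarrow> shuffle (act u x) (act v x)"
  by (induction x arbitrary: u v) (auto simp: act1_shuffle)

lemma reduced_act: "reduced w \<Longrightarrow> x \<in> lists letters \<Longrightarrow> reduced (act w x)"
  by (induction x arbitrary: w) (auto simp: letters_iff reduced_act1)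

lemma length_act1: "length (act1 w t) \<le> Suc (length w)"
  using length_del [of "vtx t" w] by (auto simp: act1_def Let_def)

lemma length_act: "length (act w x) \<le> length w + length x"
proof (induction x arbitrary: w)
  case (Cons t x)
  show ?case using Cons [of "act1 w t"] length_act1 [of w t] by simp
qed simp

section \<open>The graph product\<close>

abbreviation "F \<equiv> free_monoid letters"

abbreviation "G \<equiv> graph_product V E M"

definition eqv :: "'a list rel" where
  "eqv = generated_congruence F (graph_product_relations V E M)"

definition cls :: "'a list \<Rightarrow> 'a list set" where
  "cls u = eqv `` {u}"

lemma graph_product_eq: "G = quotient_monoid F eqv"
  by (simp add: graph_product_def eqv_def letters_def Let_def)

lemma monoid_F: "monoid F"
  by (rule Group.monoidI) (auto simp: free_monoid_def)

lemma relations_carrier: "graph_product_relations V E M \<subseteq> carrier F \<times> carrier F"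
  by (auto simp: graph_product_relations_def free_monoid_def M_simps intro: carrier_letters)

lemma congruence_eqv: "congruence F eqv"
  unfolding eqv_def by (rule congruence_generated_congruence [OF monoid_F relations_carrier])

lemma equiv_eqv: "equiv (lists letters) eqv"
  using congruence_eqv by (simp add: congruence_def free_monoid_def)

sublocale G: monoid G
  unfolding graph_product_eq by (rule monoid_quotient_monoid [OF monoid_F congruence_eqv])

lemma carrier_G: "carrier G = cls ` lists letters"
  by (auto simp: graph_product_eq quotient_monoid_def quotient_def cls_def free_monoid_def)

lemma cls_closed: "u \<in> lists letters \<Longrightarrow> cls u \<in> carrier G"
  by (simp add: carrier_G)

lemma cls_Nil: "cls [] = \<one>\<^bsub>G\<^esub>"
  by (simp add: graph_product_eq quotient_monoid_def cls_def free_monoid_def)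

lemma cls_append:
  "u \<in> lists letters \<Longrightarrow> v \<in> lists letters \<Longrightarrow> cls (u @ v) = cls u \<otimes>\<^bsub>G\<^esub> cls v"
  using mult_quotient_monoid [OF congruence_eqv, of u v]
  by (simp add: graph_product_eq cls_def free_monoid_def)

lemma cls_eq_iff:
  "u \<in> lists letters \<Longrightarrow> v \<in> lists letters \<Longrightarrow> cls u = cls v \<longleftrightarrow> (u, v) \<in> eqv"
  unfolding cls_def using eq_equiv_class_iff [OF equiv_eqv] by simp

lemma cls_relation:
  assumes "(u, v) \<in> graph_product_relations V E M"
  shows "cls u = cls v"
proof -
  have "(u, v) \<in> eqv" using assms generated_congruence_extensive by (auto simp: eqv_def)
  then show ?thesis unfolding cls_def by (rule equiv_class_eq [OF equiv_eqv])
qed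

lemma cls_one: "\<delta> \<in> V \<Longrightarrow> cls [\<one>\<^bsub>M \<delta>\<^esub>] = \<one>\<^bsub>G\<^esub>"
  by (subst cls_Nil [symmetric], rule cls_relation)
    (auto simp: graph_product_relations_def)

lemma cls_mult:
  assumes "\<delta> \<in> V" "s \<in> carrier (M \<delta>)" "t \<in> carrier (M \<delta>)"
  shows "cls [s \<otimes>\<^bsub>M \<delta>\<^esub> t] = cls [s] \<otimes>\<^bsub>G\<^esub> cls [t]"
proof -
  have "cls [s, t] = cls [s \<otimes>\<^bsub>M \<delta>\<^esub> t]"
    by (rule cls_relation) (use assms in \<open>auto simp: graph_product_relations_def\<close>)
  then show ?thesis using cls_append [of "[s]" "[t]"] assms carrier_letters by simp
qed

lemma cls_commute:
  assumes "s \<in> letters" "t \<in> letters" "adj (vtx s) (vtx t)"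
  shows "cls [s] \<otimes>\<^bsub>G\<^esub> cls [t] = cls [t] \<otimes>\<^bsub>G\<^esub> cls [s]"
proof -
  have "([s, t], [t, s]) \<in> graph_product_relations V E M"
    unfolding graph_product_relations_def using assms letters_iff adj_def by blast
  then have "cls [s, t] = cls [t, s]" by (rule cls_relation)
  then show ?thesis using cls_append [of "[s]" "[t]"] cls_append [of "[t]" "[s]"] assms by simp
qed

lemma cls_commute_word:
  assumes "t \<in> letters" "u \<in> lists letters" "\<forall>s\<in>set u. adj (vtx s) (vtx t)"
  shows "cls u \<otimes>\<^bsub>G\<^esub> cls [t] = cls [t] \<otimes>\<^bsub>G\<^esub> cls u"
  using assms(2,3)
proof (induction u)
  case (Cons s u)
  have c: "cls [s] \<in> carrier G" "cls [t] \<in> carrier G" "cls u \<in> carrier G"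
    using Cons assms(1) by (auto intro!: cls_closed)
  have su: "cls (s # u) = cls [s] \<otimes>\<^bsub>G\<^esub> cls u"
    using cls_append [of "[s]" u] Cons by simp
  have "cls (s # u) \<otimes>\<^bsub>G\<^esub> cls [t] = cls [s] \<otimes>\<^bsub>G\<^esub> (cls [t] \<otimes>\<^bsub>G\<^esub> cls u)"
    using su c Cons by (simp add: G.m_assoc)
  also have "\<dots> = (cls [t] \<otimes>\<^bsub>G\<^esub> cls [s]) \<otimes>\<^bsub>G\<^esub> cls u"
    using c cls_commute [of s t] Cons assms(1) by (simp add: G.m_assoc [symmetric])
  finally show ?case using su c by (simp add: G.m_assoc)
qed (simp add: cls_Nil cls_closed assms(1))

section \<open>Values of reversed words in the graph product\<close>

lemma cls_rev_Cons:
  "t \<in> letters \<Longrightarrow> set w \<subseteq> letters \<Longrightarrow> cls (rev (t # w)) = cls (rev w) \<otimes>\<^bsub>G\<^esub> cls [t]"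
  using cls_append [of "rev w" "[t]"] by (simp add: lists_eq_set)

lemma cls_rev_shuffle: "shuffle u v \<Longrightarrow> set u \<subseteq> letters \<Longrightarrow> cls (rev u) = cls (rev v)"
proof (induction rule: shuffle.induct)
  case (shuffle_swap s t w)
  then have c: "cls [s] \<in> carrier G" "cls [t] \<in> carrier G" "cls (rev w) \<in> carrier G"
    by (auto intro!: cls_closed)
  show ?case
    using shuffle_swap c cls_commute [of s t]
    by (simp add: cls_rev_Cons G.m_assoc del: rev.simps)
next
  case (shuffle_Cons u v t)
  then show ?case using set_shuffle [of u v] by (simp add: cls_rev_Cons del: rev.simps)
qed (use set_shuffle in auto)

lemma cls_rev_lastc_del:
  assumes "\<delta> \<in> V" "set w \<subseteq> letters"
  shows "cls (rev w) = cls (rev (del \<delta> w)) \<otimes>\<^bsub>G\<^esub> cls [lastc \<delta> w]"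
  using assms(2)
proof (induction w)
  case (Cons t w)
  let ?l = "lastc \<delta> w"
  have l: "?l \<in> carrier (M \<delta>)" using lastc_closed assms(1) Cons.prems by simp
  then have "?l \<in> letters" "vtx ?l = \<delta>" using assms(1) carrier_letters vtx_eq by auto
  moreover have d: "set (del \<delta> w) \<subseteq> letters" using set_del Cons.prems by fastforce
  ultimately have c: "cls [t] \<in> carrier G" "cls [?l] \<in> carrier G" "cls (rev w) \<in> carrier G"
      "cls (rev (del \<delta> w)) \<in> carrier G"
    using Cons.prems by (auto intro!: cls_closed)
  show ?case
  proof (cases "vtx t = \<delta> \<or> \<not> adj (vtx t) \<delta>")
    case True
    \<comment> \<open>Either \<open>t\<close> is itself the component, or it blocks the scan and the
      component is an identity letter, whose class is the unit.\<close>
    then show ?thesis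
      using Cons.prems c cls_one [OF assms(1)]
      by (auto simp: cls_rev_Cons simp del: rev.simps)
  next
    case False
    have "cls [?l] \<otimes>\<^bsub>G\<^esub> cls [t] = cls [t] \<otimes>\<^bsub>G\<^esub> cls [?l]"
      using False \<open>?l \<in> letters\<close> \<open>vtx ?l = \<delta>\<close> Cons.prems
      by (intro cls_commute) (auto simp: adj_sym)
    then show ?thesis
      using False Cons c d by (simp add: cls_rev_Cons G.m_assoc del: rev.simps)
  qed
qed (simp add: cls_Nil cls_one assms)

lemma cls_rev_del_mult:
  assumes "\<delta> \<in> V" "t \<in> carrier (M \<delta>)" "set w \<subseteq> letters"
  shows "cls (rev (del \<delta> w)) \<otimes>\<^bsub>G\<^esub> cls [lastc \<delta> w \<otimes>\<^bsub>M \<delta>\<^esub> t] = cls (rev w) \<otimes>\<^bsub>G\<^esub> cls [t]"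
proof -
  have l: "lastc \<delta> w \<in> carrier (M \<delta>)" using lastc_closed assms by simp
  have "set (del \<delta> w) \<subseteq> letters" using set_del assms by fastforce
  then have c: "cls [t] \<in> carrier G" "cls [lastc \<delta> w] \<in> carrier G"
      "cls (rev (del \<delta> w)) \<in> carrier G"
    using assms l carrier_letters by (auto intro!: cls_closed)
  show ?thesis
    using c by (simp add: cls_rev_lastc_del [OF assms(1,3)] cls_mult [OF assms(1) l assms(2)]
        G.m_assoc)
qed

lemma cls_rev_act1:
  assumes "set w \<subseteq> letters" "t \<in> letters"
  shows "cls (rev (act1 w t)) = cls (rev w) \<otimes>\<^bsub>G\<^esub> cls [t]"
proof -
  have t: "vtx t \<in> V" "t \<in> carrier (M (vtx t))" using assms letters_iff by auto
  let ?q = "lastc (vtx t) w \<otimes>\<^bsub>M (vtx t)\<^esub> t"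
  have q: "?q \<in> letters" using t lastc_closed assms by (auto intro!: carrier_letters mult_M_closed)
  have d: "set (del (vtx t) w) \<subseteq> letters" using set_del assms by fastforce
  then have "cls (rev (del (vtx t) w)) \<in> carrier G" by (auto intro!: cls_closed)
  then have "cls (rev (act1 w t)) = cls (rev (del (vtx t) w)) \<otimes>\<^bsub>G\<^esub> cls [?q]"
    using q d cls_one [OF t(1)] by (auto simp: act1_def Let_def cls_rev_Cons simp del: rev.simps)
  then show ?thesis using cls_rev_del_mult [OF t assms(1)] by simp
qed

text \<open>Links the combinatorial action with multiplication in \<open>G\<close>; started at the
  empty word, it shows that every class contains a reduced word.\<close>

lemma cls_rev_act:
  "reduced w \<Longrightarrow> x \<in> lists letters \<Longrightarrow> cls (rev (act w x)) = cls (rev w) \<otimes>\<^bsub>G\<^esub> cls x"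
proof (induction x arbitrary: w)
  case Nil
  then have "cls (rev w) \<in> carrier G" by (auto intro!: cls_closed dest: reduced_letterD)
  then show ?case by (simp add: cls_Nil)
next
  case (Cons t x)
  then have t: "vtx t \<in> V" "t \<in> carrier (M (vtx t))" "t \<in> letters" using letters_iff by auto
  have w: "set w \<subseteq> letters" using Cons.prems reduced_letters by simp
  have "cls (rev (act w (t # x))) = cls (rev (act1 w t)) \<otimes>\<^bsub>G\<^esub> cls x"
    using Cons reduced_act1 t by simp
  also have "\<dots> = cls (rev w) \<otimes>\<^bsub>G\<^esub> (cls [t] \<otimes>\<^bsub>G\<^esub> cls x)"
  proof -
    have "cls [t] \<in> carrier G" "cls x \<in> carrier G" "cls (rev w) \<in> carrier G"
      using Cons.prems w by (auto intro!: cls_closed)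
    then show ?thesis by (simp add: cls_rev_act1 w t G.m_assoc)
  qed
  also have "cls [t] \<otimes>\<^bsub>G\<^esub> cls x = cls (t # x)" using cls_append [of "[t]" x] Cons.prems by simp
  finally show ?case .
qed

text \<open>Quantifying over the word acted on makes the relation below compatible with multiplication
  on the left.\<close>

lemma eqv_act:
  assumes "(u, v) \<in> eqv" "reduced w"
  shows "shuffle (act w u) (act w v)"
proof -
  define r where "r = {(u, v). u \<in> lists letters \<and> v \<in> lists letters \<and>
    (\<forall>w. reduced w \<longrightarrow> shuffle (act w u) (act w v))}"
  have eq: "equiv (lists letters) r"
  proof (rule equivI)
    show "r \<subseteq> lists letters \<times> lists letters" by (auto simp: r_def)
    show "refl_on (lists letters) r" by (auto simp: r_def refl_on_def shuffle_refl)
    show "sym r" unfolding r_def sym_def using shuffle_sym by blast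
    show "trans r" unfolding r_def trans_def using shuffle_trans by blast
  qed
  have "(a @ c, b @ d) \<in> r" if "(a, b) \<in> r" "(c, d) \<in> r" for a b c d
  proof -
    have "shuffle (act w (a @ c)) (act w (b @ d))" if w: "reduced w" for w
    proof -
      \<comment> \<open>Exchanging \<open>a\<close> for \<open>b\<close> shuffles the word on which
        \<open>c\<close> acts, and the action respects shuffles; then \<open>c\<close> is exchanged
        for \<open>d\<close> on the reduced word \<open>act w b\<close>.\<close>
      have "shuffle (act (act w a) c) (act (act w b) c)"
        using \<open>(a, b) \<in> r\<close> w by (auto simp: r_def intro: act_shuffle)
      moreover have "shuffle (act (act w b) c) (act (act w b) d)"
        using \<open>(a, b) \<in> r\<close> \<open>(c, d) \<in> r\<close> w reduced_act by (auto simp: r_def)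
      ultimately show ?thesis by (auto intro: shuffle_trans)
    qed
    then show ?thesis using that by (auto simp: r_def)
  qed
  then have cong: "congruence F r" using eq by (auto simp: congruence_def free_monoid_def)
  have rel: "graph_product_relations V E M \<subseteq> r"
  proof
    fix z assume z: "z \<in> graph_product_relations V E M"
    then have "z \<in> carrier F \<times> carrier F" using relations_carrier by blast
    \<comment> \<open>The three kinds of defining relations are matched by \<open>act1_one\<close>,
      \<open>act1_mult\<close> and \<open>act1_commute\<close>.\<close>
    then show "z \<in> r" using z
      by (auto simp: graph_product_relations_def r_def free_monoid_def adj_def [symmetric]
          act1_one act1_mult shuffle_refl intro: act1_commute)
  qed
  show ?thesis
    using generated_congruence_least [OF cong rel] assms by (auto simp: eqv_def r_def)
qed

text \<open>Uniqueness of normal forms: acting on the empty word turns equality in \<open>G\<close>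
  into equality of reduced words up to shuffles.\<close>

lemma cls_eq_imp_shuffle:
  "u \<in> lists letters \<Longrightarrow> v \<in> lists letters \<Longrightarrow> cls u = cls v \<Longrightarrow> shuffle (act [] u) (act [] v)"
  by (simp add: cls_eq_iff eqv_act)

lemma cls_rev_normal_form: "u \<in> lists letters \<Longrightarrow> cls (rev (act [] u)) = cls u"
  using cls_rev_act [of "[]" u] by (simp add: cls_Nil cls_closed)

text \<open>The graph product is a free right \<open>M \<delta>\<close>-act.\<close>

lemma mult_letter_eq_iff:
  assumes \<delta>: "\<delta> \<in> V" "t \<in> carrier (M \<delta>)" and uv: "u \<in> lists letters" "v \<in> lists letters"
  shows "cls u \<otimes>\<^bsub>G\<^esub> cls [t] = cls v \<otimes>\<^bsub>G\<^esub> cls [t] \<longleftrightarrow>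
    shuffle (del \<delta> (act [] u)) (del \<delta> (act [] v)) \<and>
    lastc \<delta> (act [] u) \<otimes>\<^bsub>M \<delta>\<^esub> t = lastc \<delta> (act [] v) \<otimes>\<^bsub>M \<delta>\<^esub> t" (is "?L \<longleftrightarrow> ?R")
proof
  have t: "[t] \<in> lists letters" using \<delta> carrier_letters by simp
  have red: "reduced (act [] x)" if "x \<in> lists letters" for x
    using that reduced_act [of "[]"] by simp
  { assume ?L
    then have "cls (u @ [t]) = cls (v @ [t])" using cls_append uv t by simp
    then have "shuffle (act1 (act [] u) t) (act1 (act [] v) t)"
      using cls_eq_imp_shuffle [of "u @ [t]" "v @ [t]"] uv t by simp
    \<comment> \<open>Shuffles preserve \<open>lastc\<close>, and \<open>del\<close> up to shuffles,
      so both factors can be read off the products.\<close>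
    from lastc_shuffle [OF this, of \<delta>] del_shuffle [OF this, of \<delta>] show ?R
      using \<delta> red uv by (simp add: lastc_act1 del_act1) }
  { assume ?R
    moreover have "set (del \<delta> (act [] u)) \<subseteq> letters"
      using set_del reduced_letters [OF red [OF uv(1)]] by fastforce
    ultimately have "cls (rev (act [] u)) \<otimes>\<^bsub>G\<^esub> cls [t] = cls (rev (act [] v)) \<otimes>\<^bsub>G\<^esub> cls [t]"
      using cls_rev_del_mult [OF \<delta> reduced_letters [OF red [OF uv(1)]]]
        cls_rev_del_mult [OF \<delta> reduced_letters [OF red [OF uv(2)]]]
        cls_rev_shuffle [of "del \<delta> (act [] u)" "del \<delta> (act [] v)"] by simp
    then show ?L using uv by (simp add: cls_rev_normal_form) }
qed

text \<open>In \<open>mult_letter_eq_iff\<close> the letter occurs only in the condition on last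
  components, which is an equation between left multiples of that letter in
  \<open>M \<delta>\<close>; there the assumption applies.\<close>

lemma Rstar_letter:
  assumes "\<delta> \<in> V" "s \<in> carrier (M \<delta>)" "t \<in> carrier (M \<delta>)" "Rstar (M \<delta>) s t"
  shows "Rstar G (cls [s]) (cls [t])"
proof -
  have "lastc \<delta> (act [] u) \<in> carrier (M \<delta>)" if "u \<in> lists letters" for u
    using that assms(1) by (simp add: lastc_closed reduced_letters reduced_act)
  then show ?thesis
    using assms by (auto simp: Rstar_def carrier_G mult_letter_eq_iff)
qed

text \<open>With trivial last components the criterion of \<open>mult_letter_eq_iff\<close> takes
  the same truth value for every letter at \<delta>; the identity letter turns it into equality of
  classes.\<close>

lemma mult_letter_cancel:
  assumes "\<delta> \<in> V" "t \<in> carrier (M \<delta>)" "u \<in> lists letters" "v \<in> lists letters"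
    and "lastc \<delta> (act [] u) = \<one>\<^bsub>M \<delta>\<^esub>" "lastc \<delta> (act [] v) = \<one>\<^bsub>M \<delta>\<^esub>"
  shows "cls u \<otimes>\<^bsub>G\<^esub> cls [t] = cls v \<otimes>\<^bsub>G\<^esub> cls [t] \<longleftrightarrow> cls u = cls v"
  using mult_letter_eq_iff [of \<delta> t u v] mult_letter_eq_iff [of \<delta> "\<one>\<^bsub>M \<delta>\<^esub>" u v] assms
  by (simp add: cls_one one_M_closed cls_closed)

section \<open>Words without left invertible first letters\<close>

text \<open>The list \<open>w\<close> is what precedes \<open>t\<close> in the word, so a letter
  adjacent to all of it can be moved to the front. The condition forbids such a letter to be left
  invertible.\<close>

primrec noinv :: "'a list \<Rightarrow> bool" where
  "noinv [] \<longleftrightarrow> True"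
| "noinv (t # w) \<longleftrightarrow> noinv w \<and>
     ((\<forall>s\<in>set w. adj (vtx s) (vtx t)) \<longrightarrow>
      (\<forall>q\<in>carrier (M (vtx t)). q \<otimes>\<^bsub>M (vtx t)\<^esub> t \<noteq> \<one>\<^bsub>M (vtx t)\<^esub>))"

lemma not_noinv_imp:
  "\<not> noinv w \<Longrightarrow> \<exists>w1 t w2. w = w1 @ t # w2 \<and> (\<forall>s\<in>set w2. adj (vtx s) (vtx t)) \<and>
     (\<exists>q\<in>carrier (M (vtx t)). q \<otimes>\<^bsub>M (vtx t)\<^esub> t = \<one>\<^bsub>M (vtx t)\<^esub>)"
proof (induction w)
  case (Cons t w)
  show ?case
  proof (cases "noinv w")
    case True
    then show ?thesis using Cons.prems by (intro exI [of _ "[]"]) auto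
  next
    case False
    then show ?thesis using Cons.IH by (metis append_Cons)
  qed
qed simp

text \<open>An earlier letter at the vertex of \<open>t\<close> would be reachable through the star,
  contrary to reducedness.\<close>

lemma reduced_star:
  assumes "reduced (t # w)" "\<forall>s\<in>set w. vtx s = vtx t \<or> adj (vtx s) (vtx t)"
  shows "\<forall>s\<in>set w. adj (vtx s) (vtx t)"
  using reduced_star_lastc [of w "vtx t"] assms by auto

text \<open>Whatever the left factor \<open>y\<close>, a letter of \<open>v\<close> that blocks
  \<beta> survives, possibly merged with a letter of \<open>y\<close>. The vertex \<beta> is
  generalised because survival of \<open>t\<close> is checked with the induction hypothesis at the
  vertex of \<open>t\<close>.\<close>

lemma lastc_act_noinv:
  assumes y: "reduced y"
  shows "reduced v \<Longrightarrow> noinv v \<Longrightarrow> lastc \<beta> v = \<one>\<^bsub>M \<beta>\<^esub> \<Longrightarrow>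
    \<exists>s\<in>set v. vtx s \<noteq> \<beta> \<and> \<not> adj (vtx s) \<beta> \<Longrightarrow> lastc \<beta> (act y (rev v)) = \<one>\<^bsub>M \<beta>\<^esub>"
proof (induction v arbitrary: \<beta>)
  case (Cons t v)
  let ?\<delta> = "vtx t" and ?w = "act y (rev v)"
  have t: "?\<delta> \<in> V" "t \<in> carrier (M ?\<delta>)" "t \<noteq> \<one>\<^bsub>M ?\<delta>\<^esub>"
    using Cons.prems letters_iff by auto
  have w: "reduced ?w"
    using Cons.prems by (intro reduced_act y) (auto dest: reduced_letterD)
  have act: "act y (rev (t # v)) = act1 ?w t" by simp
  have ne: "?\<delta> \<noteq> \<beta>" using Cons.prems t by auto
  show ?case
  proof (cases "adj ?\<delta> \<beta>")
    case True
    then have "lastc \<beta> ?w = \<one>\<^bsub>M \<beta>\<^esub>" using Cons ne by auto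
    then show ?thesis using act lastc_act1_adj [OF w t(1,2) True] by simp
  next
    case False
    have "lastc ?\<delta> ?w \<otimes>\<^bsub>M ?\<delta>\<^esub> t \<noteq> \<one>\<^bsub>M ?\<delta>\<^esub>"
    proof (cases "\<forall>s\<in>set v. adj (vtx s) ?\<delta>")
      case True
      \<comment> \<open>A possible first letter has no left inverse, so no component coming from
        \<open>y\<close> cancels it.\<close>
      then show ?thesis using Cons.prems lastc_closed t w reduced_letters by auto
    next
      case False
      \<comment> \<open>Here an earlier letter blocks the vertex of \<open>t\<close>, so by
        induction \<open>t\<close> meets a trivial component and stays as it is.\<close>
      then have "\<exists>s\<in>set v. vtx s \<noteq> ?\<delta> \<and> \<not> adj (vtx s) ?\<delta>"
        using reduced_star Cons.prems by blast
      then have "lastc ?\<delta> ?w = \<one>\<^bsub>M ?\<delta>\<^esub>" using Cons by auto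
      then show ?thesis using t by (simp add: l_one_M)
    qed
    then show ?thesis using act lastc_act1_nonadj [OF w t(1,2)] ne False by auto
  qed
qed simp

end

section \<open>Left abundance\<close>

locale graph_of_left_abundant_monoids = graph_of_monoids +
  assumes left_abundant_M: "\<alpha> \<in> V \<Longrightarrow> left_abundant_monoid (M \<alpha>)"
begin

text \<open>The commutation clause carries the induction: it makes the idempotent of the earlier
  letters commute with the one contributed by a new letter of the first block.\<close>

lemma Rstar_idempotent_noinv:
  "reduced v \<Longrightarrow> noinv v \<Longrightarrow> \<exists>e\<in>carrier G. e \<otimes>\<^bsub>G\<^esub> e = e \<and> Rstar G (cls (rev v)) e \<and>
     (\<forall>x\<in>letters. (\<forall>s\<in>set v. adj (vtx s) (vtx x)) \<longrightarrow> e \<otimes>\<^bsub>G\<^esub> cls [x] = cls [x] \<otimes>\<^bsub>G\<^esub> e)"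
proof (induction v)
  case Nil
  show ?case by (intro bexI [of _ "\<one>\<^bsub>G\<^esub>"]) (auto simp: cls_Nil Rstar_def cls_closed)
next
  case (Cons t v)
  let ?\<delta> = "vtx t"
  have t: "?\<delta> \<in> V" "t \<in> carrier (M ?\<delta>)" "t \<in> letters"
    using Cons.prems letters_iff by auto
  have v: "reduced v" "noinv v" "lastc ?\<delta> v = \<one>\<^bsub>M ?\<delta>\<^esub>" "rev v \<in> lists letters"
    using Cons.prems by (auto dest: reduced_letterD)
  have rev: "cls (rev (t # v)) = cls (rev v) \<otimes>\<^bsub>G\<^esub> cls [t]"
    using v t by (intro cls_rev_Cons reduced_letters) auto
  have tc: "cls [t] \<in> carrier G" and vc: "cls (rev v) \<in> carrier G"
    using v t by (auto intro!: cls_closed)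
  obtain e where e: "e \<in> carrier G" "e \<otimes>\<^bsub>G\<^esub> e = e" "Rstar G (cls (rev v)) e"
    and comm: "\<And>x. x \<in> letters \<Longrightarrow> \<forall>s\<in>set v. adj (vtx s) (vtx x) \<Longrightarrow>
      e \<otimes>\<^bsub>G\<^esub> cls [x] = cls [x] \<otimes>\<^bsub>G\<^esub> e"
    using Cons v by blast
  show ?case
  proof (cases "\<forall>s\<in>set v. adj (vtx s) ?\<delta>")
    case True
    obtain f where f: "f \<in> carrier (M ?\<delta>)" "f \<otimes>\<^bsub>M ?\<delta>\<^esub> f = f" "Rstar (M ?\<delta>) t f"
      using left_abundant_monoid.Rstar_idempotent [OF left_abundant_M [OF t(1)] t(2)] by blast
    have vf: "vtx f = ?\<delta>" "f \<in> letters"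
      using vtx_eq [OF t(1) f(1)] carrier_letters [OF t(1) f(1)] .
    let ?f = "cls [f]"
    have fc: "?f \<in> carrier G" using vf by (auto intro!: cls_closed)
    have ff: "?f \<otimes>\<^bsub>G\<^esub> ?f = ?f" using cls_mult [OF t(1) f(1) f(1)] f(2) by simp
    have ef: "e \<otimes>\<^bsub>G\<^esub> ?f = ?f \<otimes>\<^bsub>G\<^esub> e" using comm vf True by simp
    \<comment> \<open>\<open>Rstar\<close> is compatible with left multiplication: \<open>f\<close>
      replaces \<open>t\<close> behind \<open>rev v\<close>, then moves to the front, where it is a
      left factor while \<open>rev v\<close> is replaced by \<open>e\<close>.\<close>
    have "Rstar G (cls (rev v) \<otimes>\<^bsub>G\<^esub> cls [t]) (cls (rev v) \<otimes>\<^bsub>G\<^esub> ?f)"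
      using Rstar_letter [OF t(1,2) f(1,3)] tc fc vc by (intro G.Rstar_left_mult)
    also have "cls (rev v) \<otimes>\<^bsub>G\<^esub> ?f = ?f \<otimes>\<^bsub>G\<^esub> cls (rev v)"
      using True v vf by (intro cls_commute_word) auto
    finally have R: "Rstar G (cls (rev (t # v))) (?f \<otimes>\<^bsub>G\<^esub> e)"
      using G.Rstar_left_mult [OF e(3) vc e(1) fc] rev Rstar_trans by metis
    have "(?f \<otimes>\<^bsub>G\<^esub> e) \<otimes>\<^bsub>G\<^esub> (?f \<otimes>\<^bsub>G\<^esub> e) = ?f \<otimes>\<^bsub>G\<^esub> (e \<otimes>\<^bsub>G\<^esub> ?f) \<otimes>\<^bsub>G\<^esub> e"
      using fc e by (simp add: G.m_assoc)
    also have "\<dots> = (?f \<otimes>\<^bsub>G\<^esub> ?f) \<otimes>\<^bsub>G\<^esub> (e \<otimes>\<^bsub>G\<^esub> e)" using fc e(1) ef by (simp add: G.m_assoc)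
    finally have id: "(?f \<otimes>\<^bsub>G\<^esub> e) \<otimes>\<^bsub>G\<^esub> (?f \<otimes>\<^bsub>G\<^esub> e) = ?f \<otimes>\<^bsub>G\<^esub> e" using ff e by simp
    have "(?f \<otimes>\<^bsub>G\<^esub> e) \<otimes>\<^bsub>G\<^esub> cls [x] = cls [x] \<otimes>\<^bsub>G\<^esub> (?f \<otimes>\<^bsub>G\<^esub> e)"
      if x: "x \<in> letters" "\<forall>s\<in>set (t # v). adj (vtx s) (vtx x)" for x
    proof -
      have xc: "cls [x] \<in> carrier G" using x by (auto intro!: cls_closed)
      have "(?f \<otimes>\<^bsub>G\<^esub> e) \<otimes>\<^bsub>G\<^esub> cls [x] = (?f \<otimes>\<^bsub>G\<^esub> cls [x]) \<otimes>\<^bsub>G\<^esub> e"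
        using fc e xc comm x by (simp add: G.m_assoc)
      also have "?f \<otimes>\<^bsub>G\<^esub> cls [x] = cls [x] \<otimes>\<^bsub>G\<^esub> ?f" using x vf by (intro cls_commute) auto
      finally show ?thesis using fc e xc by (simp add: G.m_assoc)
    qed
    then show ?thesis using R id fc e by (intro bexI [of _ "?f \<otimes>\<^bsub>G\<^esub> e"]) auto
  next
    case False
    \<comment> \<open>Now \<open>t\<close> lies outside the first block. Its vertex stays blocked
      after any left factor, so \<open>t\<close> can be cancelled on the right and \<open>e\<close>
      serves unchanged.\<close>
    then have nonadj: "\<exists>s\<in>set v. vtx s \<noteq> ?\<delta> \<and> \<not> adj (vtx s) ?\<delta>"
      using reduced_star Cons.prems by blast
    have last: "lastc ?\<delta> (act [] (x @ rev v)) = \<one>\<^bsub>M ?\<delta>\<^esub>" if "x \<in> lists letters" for x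
      using lastc_act_noinv [OF _ v(1-3) nonadj, of "act [] x"] reduced_act [of "[]" x] that by simp
    have "Rstar G (cls (rev v) \<otimes>\<^bsub>G\<^esub> cls [t]) (cls (rev v))"
      unfolding Rstar_def
    proof (intro ballI)
      fix g h assume "g \<in> carrier G" "h \<in> carrier G"
      then obtain x y where xy: "g = cls x" "h = cls y" "x \<in> lists letters" "y \<in> lists letters"
        by (auto simp: carrier_G)
      have "cls (x @ rev v) \<otimes>\<^bsub>G\<^esub> cls [t] = cls (y @ rev v) \<otimes>\<^bsub>G\<^esub> cls [t] \<longleftrightarrow>
          cls (x @ rev v) = cls (y @ rev v)"
        using xy v t last by (intro mult_letter_cancel) auto
      then show "g \<otimes>\<^bsub>G\<^esub> (cls (rev v) \<otimes>\<^bsub>G\<^esub> cls [t]) = h \<otimes>\<^bsub>G\<^esub> (cls (rev v) \<otimes>\<^bsub>G\<^esub> cls [t]) \<longleftrightarrow>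
          g \<otimes>\<^bsub>G\<^esub> cls (rev v) = h \<otimes>\<^bsub>G\<^esub> cls (rev v)"
        using xy v(4) tc vc by (simp add: cls_append cls_closed G.m_assoc)
    qed
    then have "Rstar G (cls (rev (t # v))) e" using rev e Rstar_trans by metis
    then show ?thesis using e comm by (intro bexI [of _ e]) auto
  qed
qed

text \<open>The induction runs over all words, so the word left after removing a left invertible
  first letter need not be checked for reducedness. Passing to the normal form never increases the
  length.\<close>

lemma Rstar_idempotent_word:
  "u \<in> lists letters \<Longrightarrow> \<exists>e\<in>carrier G. e \<otimes>\<^bsub>G\<^esub> e = e \<and> Rstar G (cls u) e"
proof (induction "length u" arbitrary: u rule: less_induct)
  case less
  define w where "w = act [] u"
  have w: "reduced w" "length w \<le> length u" "cls (rev w) = cls u"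
    using less.prems reduced_act length_act [of "[]" u] by (auto simp: w_def cls_rev_normal_form)
  show ?case
  proof (cases "noinv w")
    case True
    show ?thesis using Rstar_idempotent_noinv [OF w(1) True] unfolding w(3) by blast
  next
    case False
    \<comment> \<open>Lists are reversed: \<open>w2\<close> holds the letters before
      \<open>t\<close> and \<open>w1\<close> those after it, so \<open>t\<close> commutes to the
      front of the word.\<close>
    obtain w1 t w2 q where dec: "w = w1 @ t # w2" and adj: "\<forall>s\<in>set w2. adj (vtx s) (vtx t)"
      and q: "q \<in> carrier (M (vtx t))" "q \<otimes>\<^bsub>M (vtx t)\<^esub> t = \<one>\<^bsub>M (vtx t)\<^esub>"
      using not_noinv_imp [OF False] by blast
    have X: "t \<in> letters" "rev w1 \<in> lists letters" "rev w2 \<in> lists letters"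
      using reduced_letters [OF w(1)] dec by auto
    then have t: "vtx t \<in> V" "t \<in> carrier (M (vtx t))" using letters_iff by auto
    let ?b = "rev w2 @ rev w1"
    have c: "cls [t] \<in> carrier G" "cls [q] \<in> carrier G" "cls (rev w1) \<in> carrier G"
      "cls (rev w2) \<in> carrier G" "cls ?b \<in> carrier G"
      using X q t carrier_letters by (auto intro!: cls_closed)
    have "length ?b < length u" using w(2) dec by simp
    then obtain e where e: "e \<in> carrier G" "e \<otimes>\<^bsub>G\<^esub> e = e" "Rstar G (cls ?b) e"
      using less.hyps [of ?b] X by auto
    have qt: "cls [q] \<otimes>\<^bsub>G\<^esub> cls [t] = \<one>\<^bsub>G\<^esub>"
      using cls_mult [OF t(1) q(1) t(2)] q(2) cls_one [OF t(1)] by simp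
    have "cls u = (cls (rev w2) \<otimes>\<^bsub>G\<^esub> cls [t]) \<otimes>\<^bsub>G\<^esub> cls (rev w1)"
      using w(3) dec X cls_append [of "rev w2 @ [t]" "rev w1"] cls_append [of "rev w2" "[t]"]
      by simp
    also have "cls (rev w2) \<otimes>\<^bsub>G\<^esub> cls [t] = cls [t] \<otimes>\<^bsub>G\<^esub> cls (rev w2)"
      using X adj by (intro cls_commute_word) auto
    finally have "cls u = cls [t] \<otimes>\<^bsub>G\<^esub> cls ?b"
      using c X cls_append [of "rev w2" "rev w1"] by (simp add: G.m_assoc)
    then show ?thesis
      using G.Rstar_idempotent_left_invertible_mult [OF c(1,2,5) e(1) qt e(2,3)] by simp
  qed
qed

lemma left_abundant_graph_product: "left_abundant_monoid G"
  by unfold_locales (use Rstar_idempotent_word in \<open>auto simp: carrier_G\<close>)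

end

theorem theorem5p22:
  fixes V :: "'v set" and E :: "'v set set" and M :: "'v \<Rightarrow> ('a, 'm) monoid_scheme"
  assumes "simple_graph V E"
    and "disjoint_family_on (\<lambda>\<alpha>. carrier (M \<alpha>)) V"
    and "\<And>\<alpha>. \<alpha> \<in> V \<Longrightarrow> left_abundant_monoid (M \<alpha>)"
  shows "left_abundant_monoid (graph_product V E M)"
proof -
  interpret graph_of_left_abundant_monoids V E M
    by (intro graph_of_left_abundant_monoids.intro graph_of_monoids.intro
        graph_of_monoids_axioms.intro graph_of_left_abundant_monoids_axioms.intro)
      (use assms left_abundant_monoid.axioms(1) in blast)+
  show ?thesis by (rule left_abundant_graph_product)
qed

end
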